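(* For every integer $n\ge 2$, six cops suffice to catch the robber on the graph $DG_n$; that is, $\mathrm{ent}(DG_n)\le 6$. Here $DG_n$ is the $3$-regular graph on $2n$ vertices obtained by taking a Hamilton cycle of length $2n$ with vertices $u_1,u_2,\ldots,u_n,v_1,v_2,\ldots,v_n$ in this cyclic order and connecting every vertex to its antipode on the cycle by an edge, i.e. adding the $n$ edges $\{u_i,v_i\}$ for $1\le i\le n$.
   Context: Entanglement game on a finite undirected graph $G$ with $k$ cops: First the robber chooses a starting vertex, and all $k$ cops are outside the graph. In every turn, the cops either all stay where they are, or exactly one of them flies (from wherever it is, on or off the graph) to the current position of the robber. Regardless of which of these happened, the robber then has to move to a neighbor of his current position that is not occupied by a cop. If there is no such neighbor, the cops win. The robber wins if he can run away indefinitely. Both sides have full information. The entanglement number $\mathrm{ent}(G)$ is the minimal integer $k$ such that $k$ cops have a strategy to catch the robber on $G$. *)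

theory Defs
  imports Main
begin

type_synonym 'v graph = "'v set \<times> 'v set set"

definition simple_graph :: "'v graph \<Rightarrow> bool" where
  "simple_graph G \<longleftrightarrow> finite (fst G) \<and> (\<forall>e \<in> snd G. e \<subseteq> fst G \<and> card e = 2)"

definition neighbors :: "'v graph \<Rightarrow> 'v \<Rightarrow> 'v set" where
  "neighbors G x = {y. {x, y} \<in> snd G}"

text \<open>
  A cop strategy sees the list of all robber positions so far, in chronological order and
  ending with the current one. This is full information: the earlier moves of the cops are
  determined by the strategy and these positions. The answer \<open>None\<close> means that all cops
  stay, and \<open>Some i\<close> that cop \<open>i\<close> flies to the current position of the robber.
\<close>

type_synonym 'v cop_strategy = "'v list \<Rightarrow> nat option"

definition strategy_for :: "nat \<Rightarrow> 'v cop_strategy \<Rightarrow> bool" where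
  "strategy_for k \<sigma> \<longleftrightarrow> (\<forall>h i. \<sigma> h = Some i \<longrightarrow> i < k)"

text \<open>
  \<open>cops_at \<sigma> r t i\<close> is the place of cop \<open>i\<close> after \<open>t\<close> turns of the cops (\<open>None\<close> if
  outside the graph), where \<open>r t\<close> is the robber's position after \<open>t\<close> robber moves.
\<close>

primrec cops_at :: "'v cop_strategy \<Rightarrow> (nat \<Rightarrow> 'v) \<Rightarrow> nat \<Rightarrow> nat \<Rightarrow> 'v option" where
  "cops_at \<sigma> r 0 = (\<lambda>i. None)"
| "cops_at \<sigma> r (Suc t) =
     (case \<sigma> (map r [0..<Suc t]) of
        None \<Rightarrow> cops_at \<sigma> r t
      | Some i \<Rightarrow> (cops_at \<sigma> r t)(i := Some (r t)))"

definition escapes :: "'v graph \<Rightarrow> nat \<Rightarrow> 'v cop_strategy \<Rightarrow> (nat \<Rightarrow> 'v) \<Rightarrow> bool" where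
  "escapes G k \<sigma> r \<longleftrightarrow>
     r 0 \<in> fst G \<and>
     (\<forall>t. r (Suc t) \<in> neighbors G (r t) \<and>
          (\<forall>i<k. cops_at \<sigma> r (Suc t) i \<noteq> Some (r (Suc t))))"

text \<open>
  A play that is not infinite ends with the robber having no legal move, hence with a win
  of the cops. So a strategy catches the robber iff no infinite play is consistent with it.
\<close>

definition cops_win :: "'v graph \<Rightarrow> nat \<Rightarrow> bool" where
  "cops_win G k \<longleftrightarrow> (\<exists>\<sigma>. strategy_for k \<sigma> \<and> \<not> (\<exists>r. escapes G k \<sigma> r))"

definition ent :: "'v graph \<Rightarrow> nat" where
  "ent G = (LEAST k. cops_win G k)"

text \<open>On a finite graph the minimum in \<open>ent\<close> is over a nonempty set.\<close>

lemma cops_win_card: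
  assumes "simple_graph G"
  shows "cops_win G (card (fst G))"
proof -
  have fin: "finite (fst G)" using assms by (simp add: simple_graph_def)
  obtain f where f: "bij_betw f (fst G) {0..<card (fst G)}"
    using ex_bij_betw_finite_nat[OF fin] by blast
  define \<sigma> :: "'a cop_strategy" where
    "\<sigma> h = (if h \<noteq> [] \<and> last h \<in> fst G then Some (f (last h)) else None)" for h
  have s: "strategy_for (card (fst G)) \<sigma>"
    using f by (auto simp: strategy_for_def \<sigma>_def bij_betw_def)
  have "\<not> escapes G (card (fst G)) \<sigma> r" for r
  proof
    assume e: "escapes G (card (fst G)) \<sigma> r"
    have V: "r t \<in> fst G" for t
    proof (induction t)
      case 0
      show ?case using e by (simp add: escapes_def)
    next
      case (Suc t)
      have "{r t, r (Suc t)} \<in> snd G" using e by (simp add: escapes_def neighbors_def)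
      then show ?case using assms unfolding simple_graph_def by blast
    qed
    have step: "cops_at \<sigma> r (Suc t) = (cops_at \<sigma> r t)(f (r t) := Some (r t))" for t
      using V by (simp add: \<sigma>_def)
    have guard: "s < t \<Longrightarrow> cops_at \<sigma> r t (f (r s)) = Some (r s)" for s t
    proof (induction t)
      case 0
      then show ?case by simp
    next
      case (Suc t)
      have "f (r s) = f (r t) \<Longrightarrow> r s = r t"
        using f V by (auto simp: bij_betw_def inj_on_def)
      then show ?case using Suc step[of t] by (cases "s = t") auto
    qed
    have bound: "f (r s) < card (fst G)" for s
      using f V[of s] by (auto simp: bij_betw_def)
    have neq: "r s \<noteq> r t" if st: "s < t" for s t
    proof -
      obtain t' where t': "t = Suc t'" using st by (cases t) auto
      have "cops_at \<sigma> r (Suc t') (f (r s)) \<noteq> Some (r (Suc t'))"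
        using e bound[of s] unfolding escapes_def by blast
      then show ?thesis using guard[OF st] t' by auto
    qed
    have "inj r" by (rule linorder_injI) (use neq in blast)
    then have "infinite (range r)" using finite_imageD infinite_UNIV_nat by blast
    moreover have "range r \<subseteq> fst G" using V by blast
    ultimately show False using fin finite_subset by blast
  qed
  then show ?thesis using s by (auto simp: cops_win_def)
qed

datatype dg_vertex = U nat | V nat

definition DG :: "nat \<Rightarrow> dg_vertex graph" where
  "DG n =
     (U ` {1..n} \<union> V ` {1..n},
      {{U i, U (Suc i)} | i. 1 \<le> i \<and> i < n} \<union> {{U n, V 1}} \<union>
      {{V i, V (Suc i)} | i. 1 \<le> i \<and> i < n} \<union> {{V n, U 1}} \<union>
      {{U i, V i} | i. 1 \<le> i \<and> i \<le> n})"

lemma simple_graph_DG: "n \<ge> 2 \<Longrightarrow> simple_graph (DG n)"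
  by (auto simp: simple_graph_def DG_def)

lemma card_vertices_DG: "card (fst (DG n)) = 2 * n"
proof -
  have "card (U ` {1..n} \<union> V ` {1..n}) = card (U ` {1..n}) + card (V ` {1..n})"
    by (rule card_Un_disjoint) auto
  then show ?thesis by (simp add: DG_def card_image inj_on_def)
qed

lemma neighbors_DG_U:
  assumes "n \<ge> 2" "1 \<le> i" "i \<le> n"
  shows "neighbors (DG n) (U i) =
    {V i, if i = n then V 1 else U (Suc i), if i = 1 then V n else U (i - 1)}"
  using assms by (cases i) (auto simp: neighbors_def DG_def doubleton_eq_iff)

lemma neighbors_DG_V:
  assumes "n \<ge> 2" "1 \<le> i" "i \<le> n"
  shows "neighbors (DG n) (V i) =
    {U i, if i = n then U 1 else V (Suc i), if i = 1 then U n else V (i - 1)}"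
  using assms by (cases i) (auto simp: neighbors_def DG_def doubleton_eq_iff)

lemma three_regular_DG:
  assumes "n \<ge> 2" "x \<in> fst (DG n)"
  shows "card (neighbors (DG n) x) = 3"
proof -
  from assms(2) consider i where "x = U i" "1 \<le> i" "i \<le> n" | i where "x = V i" "1 \<le> i" "i \<le> n"
    by (auto simp: DG_def)
  then show ?thesis
    by cases (use assms(1) in \<open>auto simp: neighbors_DG_U neighbors_DG_V card_insert_if\<close>)
qed

end

(* Unroll the Hamilton cycle to the integers: vertex z has neighbours z - 1, z + 1 and z + n, with
   period 2 n. While a cop guards the vertex the robber has just left, the robber either keeps
   running along the cycle or takes a chord; in the latter case two cops close that chord (a rung of
   the Moebius ladder). Two cops alternate in trailing him, and a standing cop somewhere ahead on
   the cycle forces him to take a chord eventually. Two closed rungs confine him to a strip of the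
   ladder; four cops hold the two rungs, and the two others trail him until he closes a rung
   inside the strip, which makes the strip shorter. *)

theory Submission
  imports Defs
begin

section \<open>Winning positions\<close>

text \<open>
  Cops that are no longer needed are forgotten: \<open>S\<close> is a set of vertices that are known to be
  occupied, so the identities of the cops and the remaining ones do not matter.
\<close>

inductive winning :: "'v graph \<Rightarrow> nat \<Rightarrow> 'v set \<Rightarrow> 'v \<Rightarrow> bool" for G k where
  step: "\<lbrakk>S' \<subseteq> insert x S; finite S'; card S' \<le> k;
          \<And>y. y \<in> neighbors G x \<Longrightarrow> y \<notin> S' \<Longrightarrow> winning G k S' y\<rbrakk> \<Longrightarrow> winning G k S x"

lemma winning_mono:
  assumes "winning G k S x" "S \<subseteq> T"
  shows "winning G k T x"
  using assms by cases (blast intro: winning.step)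

section \<open>From winning positions to cop strategies\<close>

definition occupied :: "nat \<Rightarrow> (nat \<Rightarrow> 'v option) \<Rightarrow> 'v set" where
  "occupied k c = {v. \<exists>i<k. c i = Some v}"

definition fly :: "(nat \<Rightarrow> 'v option) \<Rightarrow> 'v \<Rightarrow> nat option \<Rightarrow> nat \<Rightarrow> 'v option" where
  "fly c x m = (case m of None \<Rightarrow> c | Some i \<Rightarrow> c(i := Some x))"

text \<open>If \<open>x\<close> has to be held, the remaining vertices of \<open>S'\<close> need at
  most \<open>k - 1\<close> cops, so by pigeonhole some cop is free to fly to
  \<open>x\<close>.\<close>

lemma ex_fly:
  assumes "S \<subseteq> occupied k c" "S' \<subseteq> insert x S" "finite S'" "card S' \<le> k"
  shows "\<exists>m. (\<forall>i. m = Some i \<longrightarrow> i < k) \<and> S' \<subseteq> occupied k (fly c x m)"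
proof (cases "x \<in> S'")
  case False
  then show ?thesis using assms by (intro exI[of _ None]) (auto simp: fly_def)
next
  case True
  have "\<forall>v \<in> S' - {x}. \<exists>i<k. c i = Some v"
    using assms by (auto simp: occupied_def)
  then obtain f where f: "\<forall>v \<in> S' - {x}. f v < k \<and> c (f v) = Some v"
    by metis
  have "card (f ` (S' - {x})) \<le> card (S' - {x})"
    using assms(3) by (intro card_image_le) simp
  also have "\<dots> < k"
    using assms(3,4) True card_Diff1_less[of S' x] by linarith
  finally have "card (f ` (S' - {x})) < card {..<k}" by simp
  then have "\<not> {..<k} \<subseteq> f ` (S' - {x})"
    using card_mono[of "f ` (S' - {x})" "{..<k}"] assms(3) by fastforce
  then obtain i where i: "i < k" "i \<notin> f ` (S' - {x})" by auto
  have "v \<in> occupied k (fly c x (Some i))" if "v \<in> S'" for v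
  proof (cases "v = x")
    case True
    then show ?thesis using i(1) by (auto simp: occupied_def fly_def)
  next
    case False
    then have "f v < k" "c (f v) = Some v" "f v \<noteq> i" using f i(2) that by auto
    then show ?thesis by (auto simp: occupied_def fly_def)
  qed
  then show ?thesis using i(1) by (intro exI[of _ "Some i"]) auto
qed

text \<open>Generalizes \<open>cops_at\<close> to an arbitrary initial placement, so that the rest
  of a play after one turn is again a play of this kind.\<close>

primrec cops_from ::
    "(nat \<Rightarrow> 'v option) \<Rightarrow> 'v cop_strategy \<Rightarrow> (nat \<Rightarrow> 'v) \<Rightarrow> nat \<Rightarrow> nat \<Rightarrow> 'v option" where
  "cops_from c \<sigma> r 0 = c"
| "cops_from c \<sigma> r (Suc t) = fly (cops_from c \<sigma> r t) (r t) (\<sigma> (map r [0..<Suc t]))"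

lemma cops_at_eq_cops_from: "cops_at \<sigma> r t = cops_from (\<lambda>i. None) \<sigma> r t"
  by (induction t) (auto simp: fly_def split: option.split)

lemma cops_from_cong:
  assumes "\<And>t. \<sigma> (map r [0..<Suc t]) = \<tau> (map r [0..<Suc t])"
  shows "cops_from c \<sigma> r t = cops_from c \<tau> r t"
  by (induction t) (simp_all only: cops_from.simps assms)

lemma cops_from_shift:
  assumes "\<And>t. \<sigma> (r 0 # map (\<lambda>s. r (Suc s)) [0..<Suc t]) = \<tau> (map (\<lambda>s. r (Suc s)) [0..<Suc t])"
  shows "cops_from c \<sigma> r (Suc t) = cops_from (fly c (r 0) (\<sigma> [r 0])) \<tau> (\<lambda>s. r (Suc s)) t"
proof (induction t)
  case 0
  show ?case by simp
next
  case (Suc t)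
  have "map r [0..<Suc (Suc t)] = r 0 # map (\<lambda>s. r (Suc s)) [0..<Suc t]"
    by (rule map_upt_Suc)
  then have "\<sigma> (map r [0..<Suc (Suc t)]) = \<tau> (map (\<lambda>s. r (Suc s)) [0..<Suc t])"
    by (simp only: assms)
  with Suc show ?case by (simp only: cops_from.simps(2)[where t = "Suc t"] cops_from.simps(2)[where r = "\<lambda>s. r (Suc s)"])
qed

definition evades ::
    "'v graph \<Rightarrow> nat \<Rightarrow> (nat \<Rightarrow> 'v option) \<Rightarrow> 'v cop_strategy \<Rightarrow> (nat \<Rightarrow> 'v) \<Rightarrow> bool" where
  "evades G k c \<sigma> r \<longleftrightarrow> (\<forall>t. r (Suc t) \<in> neighbors G (r t) \<and>
     r (Suc t) \<notin> occupied k (cops_from c \<sigma> r (Suc t)))"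

text \<open>Outside \<open>P\<close> the default is the strategy that never moves a cop. Every
  \<open>\<tau> y\<close> is thus legal, and so are strategies assembled from them.\<close>

lemma strategy_choice:
  assumes "\<forall>y. P y \<longrightarrow> (\<exists>\<sigma>. strategy_for k \<sigma> \<and> Q y \<sigma>)"
  shows "\<exists>\<tau>. \<forall>y. strategy_for k (\<tau> y) \<and> (P y \<longrightarrow> Q y (\<tau> y))"
proof -
  have "strategy_for k (\<lambda>_. None)" by (simp add: strategy_for_def)
  then have "\<forall>y. \<exists>\<sigma>. strategy_for k \<sigma> \<and> (P y \<longrightarrow> Q y \<sigma>)"
    using assms by blast
  then show ?thesis by (rule choice)
qed

text \<open>Induction on the winning tree: make the first move, then follow the strategy for the
  subgame that the robber's answer selects. The placement \<open>c\<close> stays arbitrary because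
  the move changes it.\<close>

lemma winning_strategy:
  assumes "winning G k S x" "S \<subseteq> occupied k c"
  shows "\<exists>\<sigma>. strategy_for k \<sigma> \<and> (\<forall>r. r 0 = x \<longrightarrow> \<not> evades G k c \<sigma> r)"
  using assms
proof (induction arbitrary: c rule: winning.induct)
  case (step S' x S)
  obtain m where m: "\<forall>i. m = Some i \<longrightarrow> i < k" "S' \<subseteq> occupied k (fly c x m)"
    using ex_fly[OF step.prems step.hyps(1-3)] by blast
  let ?c = "fly c x m"
  have "\<forall>y. y \<in> neighbors G x - S' \<longrightarrow>
      (\<exists>\<tau>. strategy_for k \<tau> \<and> (\<forall>r. r 0 = y \<longrightarrow> \<not> evades G k ?c \<tau> r))"
    using step.IH[OF _ _ m(2)] by blast
  from strategy_choice[OF this] obtain \<tau> where \<tau>: "\<And>y. strategy_for k (\<tau> y)"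
      "\<And>y r. y \<in> neighbors G x - S' \<Longrightarrow> r 0 = y \<Longrightarrow> \<not> evades G k ?c (\<tau> y) r"
    by blast
  \<comment> \<open>The second position of the history selects the subgame, whose own history is the
    tail.\<close>
  define \<sigma> where "\<sigma> h = (if tl h = [] then m else \<tau> (hd (tl h)) (tl h))" for h
  have "strategy_for k \<sigma>"
    using m(1) \<tau>(1) by (auto simp: strategy_for_def \<sigma>_def)
  moreover have "\<not> evades G k c \<sigma> r" if r0: "r 0 = x" for r
  proof
    assume e: "evades G k c \<sigma> r"
    have \<sigma>0: "\<sigma> [x] = m" by (simp add: \<sigma>_def)
    have shift: "cops_from c \<sigma> r (Suc t) = cops_from ?c (\<tau> (r 1)) (\<lambda>s. r (Suc s)) t" for t
    proof -
      have "\<sigma> (r 0 # map (\<lambda>s. r (Suc s)) [0..<Suc t]) = \<tau> (r 1) (map (\<lambda>s. r (Suc s)) [0..<Suc t])" for t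
        by (simp add: \<sigma>_def hd_append hd_map upt_rec[of 0 t])
      from cops_from_shift[where \<tau> = "\<tau> (r 1)", OF this] show ?thesis
        using r0 \<sigma>0 by (simp only:)
    qed
    have e': "r (Suc t) \<in> neighbors G (r t)"
        "r (Suc t) \<notin> occupied k (cops_from ?c (\<tau> (r 1)) (\<lambda>s. r (Suc s)) t)" for t
      using e shift unfolding evades_def by auto
    have r1: "r 1 \<in> neighbors G x - S'"
      using e'[of 0] m(2) r0 by auto
    have "evades G k ?c (\<tau> (r 1)) (\<lambda>s. r (Suc s))"
      unfolding evades_def using e' by blast
    moreover have "\<not> evades G k ?c (\<tau> (r 1)) (\<lambda>s. r (Suc s))"
      by (rule \<tau>(2)[OF r1]) simp
    ultimately show False by contradiction
  qed
  ultimately show ?case by (intro exI[of _ \<sigma>]) simp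
qed

lemma cops_win_if_winning:
  assumes "\<And>x. x \<in> fst G \<Longrightarrow> winning G k {} x"
  shows "cops_win G k"
proof -
  have "\<forall>x. x \<in> fst G \<longrightarrow>
      (\<exists>\<sigma>. strategy_for k \<sigma> \<and> (\<forall>r. r 0 = x \<longrightarrow> \<not> evades G k (\<lambda>i. None) \<sigma> r))"
    using winning_strategy[OF assms] by simp
  from strategy_choice[OF this] obtain \<tau> where \<tau>: "\<And>x. strategy_for k (\<tau> x)"
      "\<And>x r. x \<in> fst G \<Longrightarrow> r 0 = x \<Longrightarrow> \<not> evades G k (\<lambda>i. None) (\<tau> x) r"
    by blast
  \<comment> \<open>The head of the history is the robber's starting vertex.\<close>
  define \<sigma> where "\<sigma> h = \<tau> (hd h) h" for h
  have "\<not> escapes G k \<sigma> r" for r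
  proof
    assume e: "escapes G k \<sigma> r"
    have "cops_at \<sigma> r t = cops_from (\<lambda>i. None) (\<tau> (r 0)) r t" for t
      unfolding cops_at_eq_cops_from
      by (rule cops_from_cong) (simp add: \<sigma>_def hd_append hd_map upt_rec[of 0])
    then have "evades G k (\<lambda>i. None) (\<tau> (r 0)) r"
      using e by (simp del: cops_at.simps cops_from.simps add: evades_def escapes_def occupied_def)
    then show False using e \<tau>(2) unfolding escapes_def by blast
  qed
  moreover have "strategy_for k \<sigma>"
    using \<tau>(1) by (auto simp: strategy_for_def \<sigma>_def)
  ultimately show ?thesis unfolding cops_win_def by blast
qed

section \<open>Cycles with antipodal chords\<close>

text \<open>Integer positions let "ahead" and "between" be expressed by the linear order, which a
  cycle does not have.\<close>

locale antipodal_cycle =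
  fixes G :: "'v graph" and p :: "int \<Rightarrow> 'v" and n :: int
  assumes n_ge_2: "n \<ge> 2"
    and periodic: "p (z + 2 * n) = p z"
    and neighbors_subset: "neighbors G (p z) \<subseteq> {p (z + 1), p (z - 1), p (z + n)}"
begin

definition rung :: "int \<Rightarrow> 'v set" where
  "rung z = {p z, p (z + n)}"

text \<open>Both ends name the same chord, so a strip from \<open>a\<close> to \<open>b\<close> is
  also one from \<open>a + n\<close> to \<open>b + n\<close>.\<close>

lemma rung_shift: "rung (z + n) = rung z"
  using periodic[of z] by (auto simp: rung_def algebra_simps)

section \<open>Trailing cops and shrinking strips\<close>

lemma card_Un_le_6:
  assumes "finite F" "card F \<le> 4"
  shows "card (F \<union> {a, b}) \<le> 6"
proof -
  have "card (F \<union> {a, b}) \<le> card F + card {a, b}" by (rule card_Un_le)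
  moreover have "card {a, b} \<le> 2" by (simp add: card_insert_if)
  ultimately show ?thesis using assms(2) by linarith
qed

text \<open>The robber has crossed a chord whose other end is held. A cop landing on him closes the
  rung, so he can only continue along the cycle.\<close>

lemma close_rung:
  assumes "finite F" "card F \<le> 4"
    and "F \<union> {p z} \<subseteq> S"
    and "\<And>r. r \<in> {p (z + n + 1), p (z + n - 1)} \<Longrightarrow> r \<notin> F \<Longrightarrow> winning G 6 (F \<union> rung z) r"
  shows "winning G 6 S (p (z + n))"
proof (rule winning.step)
  show "F \<union> rung z \<subseteq> insert (p (z + n)) S" using assms(3) by (auto simp: rung_def)
  show "finite (F \<union> rung z)" using assms(1) by (simp add: rung_def)
  show "card (F \<union> rung z) \<le> 6" unfolding rung_def using assms(1,2) by (rule card_Un_le_6)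
  fix y assume "y \<in> neighbors G (p (z + n))" "y \<notin> F \<union> rung z"
  moreover have "p (z + n + n) = p z" using periodic[of z] by (simp add: algebra_simps)
  ultimately show "winning G 6 (F \<union> rung z) y"
    using neighbors_subset[of "z + n"] assms(4)[of y] by (auto simp: rung_def)
qed

text \<open>Induction on the distance \<open>m\<close> to the guard ahead in direction
  \<open>d\<close>. One cop holds the vertex just left and the other lands on the robber, so he
  cannot turn back; he must take a chord at the latest next to the guard.\<close>

lemma chase:
  assumes F: "finite F" "card F \<le> 4" and d: "d \<in> {1, - 1}"
    and "p (z + int m * d) \<in> F" "m \<ge> 1"
    and "\<And>j r. j < m \<Longrightarrow> r \<in> {p (z + int j * d + n + 1), p (z + int j * d + n - 1)} \<Longrightarrow> r \<notin> F \<Longrightarrow>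
      winning G 6 (F \<union> rung (z + int j * d)) r"
  shows "winning G 6 (F \<union> {p (z - d)}) (p z)"
  using assms(4-)
proof (induction m arbitrary: z)
  case 0
  then show ?case by simp
next
  case (Suc m)
  let ?S = "F \<union> {p (z - d), p z}"
  show ?case
  proof (rule winning.step)
    show "?S \<subseteq> insert (p z) (F \<union> {p (z - d)})" by auto
    show "finite ?S" using F by simp
    show "card ?S \<le> 6" using F by (rule card_Un_le_6)
    fix y assume y: "y \<in> neighbors G (p z)" "y \<notin> ?S"
    have "y \<in> {p (z + d), p (z - d), p (z + n)}"
      using neighbors_subset[of z] d y(1) by auto
    then consider "y = p (z + d)" | "y = p (z + n)" using y(2) by blast
    then show "winning G 6 ?S y"
    proof cases
      case 1
      have shift: "z + d + int j * d = z + int (Suc j) * d" for j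
        by (simp add: algebra_simps)
      \<comment> \<open>Otherwise the vertex ahead is the guard's.\<close>
      have "m \<noteq> 0" using Suc.prems(1) y(2) 1 by (intro notI) simp
      then have "winning G 6 (F \<union> {p (z + d - d)}) (p (z + d))"
      proof (intro Suc.IH)
        show "p (z + d + int m * d) \<in> F" using Suc.prems(1) by (simp only: shift)
        show "m \<ge> 1" using \<open>m \<noteq> 0\<close> by simp
        fix j r assume "j < m" "r \<in> {p (z + d + int j * d + n + 1), p (z + d + int j * d + n - 1)}" "r \<notin> F"
        then show "winning G 6 (F \<union> rung (z + d + int j * d)) r"
          unfolding shift by (intro Suc.prems(3)) simp_all
      qed
      \<comment> \<open>The cop at \<open>p (z - d)\<close> is released and trails next.\<close>
      then show ?thesis unfolding 1 by (rule winning_mono) auto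
    next
      case 2
      show ?thesis unfolding 2
      proof (rule close_rung[OF F])
        show "F \<union> {p z} \<subseteq> ?S" by auto
      qed (use Suc.prems(3)[of 0] in auto)
    qed
  qed
qed

text \<open>The first move out of \<open>p z\<close> fixes the direction, and either
  \<open>a\<close> or \<open>b\<close> then serves as the guard ahead. The two guards may be the
  same vertex.\<close>

lemma trap:
  assumes F: "finite F" "card F \<le> 4"
    and "a < z" "z < b" "p a \<in> F" "p b \<in> F"
    and H: "\<And>y r. a < y \<Longrightarrow> y < b \<Longrightarrow> r \<in> {p (y + n + 1), p (y + n - 1)} \<Longrightarrow> r \<notin> F \<Longrightarrow>
      winning G 6 (F \<union> rung y) r"
  shows "winning G 6 F (p z)"
proof (rule winning.step)
  let ?S = "F \<union> {p z}"
  show "?S \<subseteq> insert (p z) F" by auto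
  show "finite ?S" using F by simp
  show "card ?S \<le> 6" using card_Un_le_6[OF F, of "p z" "p z"] by simp
  fix y assume y: "y \<in> neighbors G (p z)" "y \<notin> ?S"
  consider "y = p (z + 1)" | "y = p (z - 1)" | "y = p (z + n)"
    using neighbors_subset[of z] y(1) by blast
  then show "winning G 6 ?S y"
  proof cases
    case 1
    then have "z + 1 \<noteq> b" using y(2) assms(6) by auto
    then have "winning G 6 (F \<union> {p (z + 1 - 1)}) (p (z + 1))"
      using assms(3-6) by (intro chase[OF F, where m = "nat (b - z - 1)"] H) auto
    then show ?thesis using 1 by simp
  next
    case 2
    then have "z - 1 \<noteq> a" using y(2) assms(5) by auto
    then have "winning G 6 (F \<union> {p (z - 1 - - 1)}) (p (z - 1))"
      using assms(3-6) by (intro chase[OF F, where m = "nat (z - 1 - a)"] H) auto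
    then show ?thesis using 2 by simp
  next
    case 3
    show ?thesis unfolding 3
      by (rule close_rung[OF F]) (use H assms(3,4) in auto)
  qed
qed

text \<open>Induction on the width. The rung \<open>y\<close> closed by the robber splits the strip,
  and he comes out in one of the two parts, on the other side of the ladder. The rung bounding only
  the other part is released.\<close>

lemma strip:
  assumes "a < z" "z < b"
  shows "winning G 6 (rung a \<union> rung b) (p z)"
  using assms
proof (induction "nat (b - a)" arbitrary: a b z rule: less_induct)
  case less
  let ?F = "rung a \<union> rung b"
  show ?case
  proof (rule trap[of ?F a z b])
    show "finite ?F" by (simp add: rung_def)
    have "card (rung y) \<le> 2" for y by (simp add: rung_def card_insert_if)
    from this[of a] this[of b] show "card ?F \<le> 4"
      using card_Un_le[of "rung a" "rung b"] by linarith
    show "p a \<in> ?F" "p b \<in> ?F" by (auto simp: rung_def)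
    fix y r assume y: "a < y" "y < b" and r: "r \<in> {p (y + n + 1), p (y + n - 1)}" "r \<notin> ?F"
    consider "r = p (y + n + 1)" | "r = p (y + n - 1)" using r(1) by blast
    then show "winning G 6 (?F \<union> rung y) r"
    proof cases
      case 1
      \<comment> \<open>With \<open>y + 1 = b\<close> the robber would stand on the closed rung
        \<open>b\<close>, which is occupied.\<close>
      have "y + 1 \<noteq> b" using r(2) 1 by (auto simp: rung_def algebra_simps)
      then have "winning G 6 (rung (y + n) \<union> rung (b + n)) r"
        unfolding 1 using y by (intro less.hyps) auto
      then show ?thesis by (rule winning_mono) (auto simp: rung_shift)
    next
      case 2
      have "y - 1 \<noteq> a" using r(2) 2 by (auto simp: rung_def algebra_simps)
      then have "winning G 6 (rung (a + n) \<union> rung (y + n)) r"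
        unfolding 2 using y by (intro less.hyps) auto
      then show ?thesis by (rule winning_mono) (auto simp: rung_shift)
    qed
  qed (use less.prems in auto)
qed

text \<open>Cutting the Moebius ladder at one rung leaves a strip with that rung at both ends: it
  recurs after \<open>n\<close> steps.\<close>

lemma one_rung:
  assumes "r \<in> {p (y + n + 1), p (y + n - 1)}"
  shows "winning G 6 (rung y) r"
proof -
  have shift: "rung (y + n + n) = rung y" "rung (y + n) = rung y" by (simp_all only: rung_shift)
  have "winning G 6 (rung (y + n) \<union> rung (y + n + n)) (p (y + n + 1))"
    using n_ge_2 by (intro strip) auto
  moreover have "winning G 6 (rung y \<union> rung (y + n)) (p (y + n - 1))"
    using n_ge_2 by (intro strip) auto
  ultimately show ?thesis using assms unfolding shift by auto
qed

text \<open>The cop on the starting vertex guards both ends, since it appears at \<open>z\<close>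
  and at \<open>z + 2 * n\<close>; the first chord taken yields a closed rung.\<close>

lemma winning_start: "winning G 6 {} (p z)"
proof (rule winning.step)
  show "{p z} \<subseteq> insert (p z) {}" "finite {p z}" "card {p z} \<le> 6" by auto
  fix y assume y: "y \<in> neighbors G (p z)" "y \<notin> {p z}"
  have trapped: "winning G 6 {p z} (p x)" if "z < x" "x < z + 2 * n" for x
    using that by (intro trap[of "{p z}" z x "z + 2 * n"])
      (auto simp: periodic intro: winning_mono[OF one_rung])
  \<comment> \<open>The step back to \<open>z - 1\<close> is lifted by a period to lie between the
    two copies of the guard.\<close>
  have "y = p (z + 1) \<or> y = p (z + 2 * n - 1) \<or> y = p (z + n)"
    using neighbors_subset[of z] y(1) periodic[of "z - 1"] by (auto simp: algebra_simps)
  then show "winning G 6 {p z} y" using n_ge_2 by (auto intro: trapped)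
qed

end

section \<open>The graph \<open>DG\<close>\<close>

text \<open>Residues count from 0 and vertex indices from 1, hence \<open>Suc\<close>.\<close>

definition cyc :: "nat \<Rightarrow> int \<Rightarrow> dg_vertex" where
  "cyc n z = (let m = nat (z mod (2 * int n)) in if m < n then U (Suc m) else V (Suc (m - n)))"

lemma cyc_mod: "cyc n (z mod (2 * int n) + d) = cyc n (z + d)"
  by (simp add: cyc_def mod_add_left_eq)

lemma cyc_in_range:
  assumes "0 \<le> z" "z < 2 * int n"
  shows "cyc n z = (if z < int n then U (Suc (nat z)) else V (Suc (nat z - n)))"
  using assms by (auto simp: cyc_def Let_def)

lemma cyc_periodic: "cyc n (z + 2 * int n) = cyc n z"
  by (simp add: cyc_def)

lemma neighbors_cyc:
  assumes "n \<ge> 2"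
  shows "neighbors (DG n) (cyc n z) \<subseteq> {cyc n (z + 1), cyc n (z - 1), cyc n (z + int n)}"
proof -
  define m where "m = z mod (2 * int n)"
  have m: "0 \<le> m" "m < 2 * int n" using assms by (simp_all add: m_def)
  have eq: "cyc n z = cyc n m" "cyc n (z + 1) = cyc n (m + 1)" "cyc n (z - 1) = cyc n (m - 1)"
    "cyc n (z + int n) = cyc n (m + int n)"
    using cyc_mod[of n z 0] cyc_mod[of n z 1] cyc_mod[of n z "- 1"] cyc_mod[of n z "int n"]
    by (simp_all add: m_def)
  show ?thesis
  proof (cases "m < int n")
    case True
    define j where "j = nat m"
    have j: "m = int j" "j < n" using m True by (simp_all add: j_def)
    have "cyc n (m + 1) = (if Suc j = n then V 1 else U (Suc (Suc j)))"
      using j by (subst cyc_in_range) (auto simp: nat_add_distrib)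
    \<comment> \<open>For \<open>j = 0\<close> the argument -1 is outside the range of
      \<open>cyc_in_range\<close> and is moved up by a full period.\<close>
    moreover have "cyc n (m - 1) = (if j = 0 then V n else U j)"
      using j assms cyc_periodic[of n "m - 1"]
      by (cases j) (auto simp: cyc_in_range nat_diff_distrib nat_add_distrib nat_mult_distrib)
    moreover have "cyc n (m + int n) = V (Suc j)"
      using j by (subst cyc_in_range) (auto simp: nat_add_distrib)
    moreover have "cyc n m = U (Suc j)" using j by (subst cyc_in_range) auto
    ultimately show ?thesis using j assms by (auto simp: eq neighbors_DG_U)
  next
    case False
    define j where "j = nat (m - int n)"
    have j: "m = int n + int j" "j < n" using m False by (auto simp: j_def)
    have "cyc n (m + 1) = (if Suc j = n then U 1 else V (Suc (Suc j)))"
    proof (cases "Suc j = n")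
      case True
      then have "m + 1 = 0 + 2 * int n" using j by simp
      then have "cyc n (m + 1) = cyc n 0" by (simp only: cyc_periodic)
      then show ?thesis using True assms by (simp add: cyc_in_range)
    next
      case False
      then show ?thesis using j by (subst cyc_in_range) (auto simp: nat_add_distrib)
    qed
    moreover have "cyc n (m - 1) = (if j = 0 then U n else V j)"
      using j assms by (subst cyc_in_range) (auto simp: nat_add_distrib nat_diff_distrib)
    moreover have "cyc n (m + int n) = U (Suc j)"
    proof -
      have "m + int n = int j + 2 * int n" using j by simp
      then have "cyc n (m + int n) = cyc n (int j)" by (simp only: cyc_periodic)
      then show ?thesis using j by (simp add: cyc_in_range)
    qed
    moreover have "cyc n m = V (Suc j)"
      using j by (subst cyc_in_range) (auto simp: nat_add_distrib)
    ultimately show ?thesis using j assms by (auto simp: eq neighbors_DG_V)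
  qed
qed

lemma DG_vertex_cyc:
  assumes "x \<in> fst (DG n)"
  shows "\<exists>z. x = cyc n z"
proof -
  from assms consider i where "x = U i" "1 \<le> i" "i \<le> n" | i where "x = V i" "1 \<le> i" "i \<le> n"
    by (auto simp: DG_def)
  then show ?thesis
  proof cases
    case 1
    then have "x = cyc n (int (i - 1))" by (subst cyc_in_range) auto
    then show ?thesis by blast
  next
    case 2
    then have "x = cyc n (int (n + i - 1))" by (subst cyc_in_range) auto
    then show ?thesis by blast
  qed
qed

theorem proposition1:
  fixes n :: nat
  assumes "n \<ge> 2"
  shows "cops_win (DG n) 6 \<and> ent (DG n) \<le> 6"
proof -
  interpret antipodal_cycle "DG n" "cyc n" "int n"
    using assms by (intro antipodal_cycle.intro neighbors_cyc cyc_periodic) simp_all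
  have "winning (DG n) 6 {} x" if "x \<in> fst (DG n)" for x
    using DG_vertex_cyc[OF that] winning_start by blast
  then have "cops_win (DG n) 6" by (rule cops_win_if_winning)
  then show ?thesis unfolding ent_def by (blast intro: Least_le)
qed

end
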